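(* Let $L\ge 1$, $l\in\{1,\dots,L\}$, and consider the $l$-th layer of an LSTM network, with $n=n_{\mathrm{hu}}^{(l)}\ge 1$ hidden units, $m$-dimensional input ($m=n_u$ if $l=1$, $m=n_{\mathrm{hu}}^{(l-1)}$ if $l\ge 2$), input weights $W_j^{(l)}\in\mathbb{R}^{n\times m}$, recurrent weights $R_j^{(l)}\in\mathbb{R}^{n\times n}$ and biases $\boldsymbol b_j^{(l)}\in\mathbb{R}^n$, $j\in\{f,i,o,g\}$, i.e. the discrete-time system with state $\boldsymbol x_k^{(l)}=(\boldsymbol c_k^{(l)},\boldsymbol h_k^{(l)})\in\mathbb{R}^{2n}$ and input $\tilde{\boldsymbol u}_k^{(l)}\in\mathbb{R}^m$ $$\boldsymbol c_{k+1}^{(l)}=\boldsymbol f_k^{(l)}\circ\boldsymbol c_k^{(l)}+\boldsymbol i_k^{(l)}\circ\boldsymbol g_k^{(l)},\qquad \boldsymbol h_{k+1}^{(l)}=\boldsymbol o_k^{(l)}\circ\boldsymbol{\tanh}(\boldsymbol c_{k+1}^{(l)}),$$ where $\boldsymbol j_k^{(l)}=\boldsymbol\sigma\big(W_j^{(l)}\tilde{\boldsymbol u}_k^{(l)}+R_j^{(l)}\boldsymbol h_k^{(l)}+\boldsymbol b_j^{(l)}\big)$ for $j\in\{f,i,o\}$ and $\boldsymbol g_k^{(l)}=\boldsymbol{\tanh}\big(W_g^{(l)}\tilde{\boldsymbol u}_k^{(l)}+R_g^{(l)}\boldsymbol h_k^{(l)}+\boldsymbol b_g^{(l)}\big)$.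 Let $\boldsymbol u_{\max}\in\mathbb{R}^{n_u}$, and set $\tilde{\boldsymbol u}_{\max}^{(l)}=\boldsymbol u_{\max}$ if $l=1$ and $\tilde{\boldsymbol u}_{\max}^{(l)}=\boldsymbol 1_{n_{\mathrm{hu}}^{(l-1)}}$ if $l\ge2$. Assume that the inputs take values in $\tilde{\mathcal U}^{(l)}=\{\tilde{\boldsymbol u}\in\mathbb{R}^m:-\tilde{\boldsymbol u}_{\max}^{(l)}\le\tilde{\boldsymbol u}\le\tilde{\boldsymbol u}_{\max}^{(l)}\}$ (componentwise), and that the initial states satisfy $\boldsymbol c_0^{(l)}\in\mathbb{R}^n$, $\boldsymbol h_0^{(l)}\in(-1,1)^n$. For $j\in\{f,i,o\}$ let $$\bar\sigma_j^{(l)}=\sigma\Big(\big\|\begin{bmatrix}W_j^{(l)}\tilde{\boldsymbol u}_{\max}^{(l)} & R_j^{(l)} & \boldsymbol b_j^{(l)}\end{bmatrix}\big\|_\infty\Big).$$ If $$\bar\sigma_f^{(l)}+\bar\sigma_i^{(l)}\,\|R_g^{(l)}\|_\infty<1,$$ then the layer is ISS$_\infty$, with state set $\mathcal X=\mathbb{R}^n\times(-1,1)^n$, input set $\tilde{\mathcal U}^{(l)}$ and bias $\boldsymbol b_g^{(l)}$. That is, there exist $\beta\in\mathcal{KL}$ and $\gamma_u,\gamma_b\in\mathcal K_\infty$, not depending on $\boldsymbol b_g^{(l)}$, such that for every $k\in\mathbb{N}$, every $\boldsymbol x_0^{(l)}\in\mathcal X$, every input sequence $\tilde{\boldsymbol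 u}_0^{(l)},\dots,\tilde{\boldsymbol u}_{k-1}^{(l)}\in\tilde{\mathcal U}^{(l)}$ and every $\boldsymbol b_g^{(l)}\in\mathbb{R}^n$, $$\|\boldsymbol x_k^{(l)}\|_\infty\le\beta\big(\|\boldsymbol x_0^{(l)}\|_\infty,k\big)+\gamma_u\Big(\max_{0\le h<k}\|\tilde{\boldsymbol u}_h^{(l)}\|_\infty\Big)+\gamma_b\big(\|\boldsymbol b_g^{(l)}\|_\infty\big).$$
   Context: $\mathbb{N}$ includes $0$. $\sigma(x)=1/(1+e^{-x})$; $\boldsymbol\sigma$ and $\boldsymbol{\tanh}$ denote componentwise application; $\circ$ is the componentwise (Hadamard) product; $\boldsymbol 1_n\in\mathbb{R}^n$ is the all-ones vector. $\|\cdot\|_\infty$ is the max norm for vectors and the induced $\infty$-norm (maximum absolute row sum) for matrices; $[\,W\tilde{\boldsymbol u}_{\max}\ \ R\ \ \boldsymbol b\,]$ is the horizontal concatenation, an $n\times(n+2)$ matrix. The maximum over the empty index set (case $k=0$) is taken to be $0$. A function $\gamma:\mathbb{R}_{\ge0}\to\mathbb{R}_{\ge0}$ is of class $\mathcal K$ if it is continuous, strictly increasing and $\gamma(0)=0$; it is of class $\mathcal K_\infty$ if moreover $\gamma(s)\to\infty$ as $s\to\infty$. A function $\beta:\mathbb{R}_{\ge0}\times\mathbb{N}\to\mathbb{R}_{\ge0}$ is of class $\mathcal{KL}$ if $\beta(\cdot,k)$ is of class $\mathcal K$ for each $k$, and for each $s$ the sequence $\beta(s,\cdot)$ is nonincreasing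 and tends to $0$ as $k\to\infty$. ISS$_\infty$ (general definition): a system with states $\boldsymbol x_k\in\mathcal X\subseteq\mathbb{R}^{n_x}$, inputs $\boldsymbol u_k\in\mathcal U\subseteq\mathbb{R}^{n_u}$ and bias $\boldsymbol b$ is ISS$_\infty$ if there exist $\beta\in\mathcal{KL}$, $\gamma_u,\gamma_b\in\mathcal K_\infty$ such that $\|\boldsymbol x_k\|_\infty\le\beta(\|\boldsymbol x_0\|_\infty,k)+\gamma_u(\max_{0\le h<k}\|\boldsymbol u_h\|_\infty)+\gamma_b(\|\boldsymbol b\|_\infty)$ for all $k\in\mathbb{N}$, all $\boldsymbol x_0\in\mathcal X$, all input sequences in $\mathcal U$ and all biases $\boldsymbol b$. *)

theory Defs
  imports Complex_Main "Jordan_Normal_Form.Matrix"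
begin

(* The matrices and vectors of Jordan_Normal_Form are used, since the input dimension of a
   layer depends on its index. Inserting 0 only affects maxima over empty index sets. *)

definition vec_inf_norm :: "real vec \<Rightarrow> real" where
  "vec_inf_norm v = Max (insert 0 ((\<lambda>i. \<bar>v $ i\<bar>) ` {..<dim_vec v}))"

definition mat_inf_norm :: "real mat \<Rightarrow> real" where
  "mat_inf_norm A = Max (insert 0 ((\<lambda>i. \<Sum>j<dim_col A. \<bar>A $$ (i, j)\<bar>) ` {..<dim_row A}))"

definition hadamard :: "real vec \<Rightarrow> real vec \<Rightarrow> real vec" where
  "hadamard v w = vec (dim_vec v) (\<lambda>i. v $ i * w $ i)"

definition sigmoid :: "real \<Rightarrow> real" where
  "sigmoid x = 1 / (1 + exp (- x))"


definition class_K :: "(real \<Rightarrow> real) \<Rightarrow> bool" where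
  "class_K \<gamma> \<longleftrightarrow>
     (\<forall>s\<ge>0. \<gamma> s \<ge> 0) \<and> continuous_on {0..} \<gamma> \<and> strict_mono_on {0..} \<gamma> \<and> \<gamma> 0 = 0"

definition class_K_inf :: "(real \<Rightarrow> real) \<Rightarrow> bool" where
  "class_K_inf \<gamma> \<longleftrightarrow> class_K \<gamma> \<and> filterlim \<gamma> at_top at_top"

definition class_KL :: "(real \<Rightarrow> nat \<Rightarrow> real) \<Rightarrow> bool" where
  "class_KL \<beta> \<longleftrightarrow>
     (\<forall>k. class_K (\<lambda>s. \<beta> s k)) \<and> (\<forall>s\<ge>0. decseq (\<beta> s) \<and> \<beta> s \<longlonglongrightarrow> 0)"


(* F x u b is the successor of state x under input u and bias b. *)

primrec trajectory ::
  "(real vec \<Rightarrow> real vec \<Rightarrow> real vec \<Rightarrow> real vec) \<Rightarrow> real vec \<Rightarrow> (nat \<Rightarrow> real vec) \<Rightarrow> real vec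
     \<Rightarrow> nat \<Rightarrow> real vec" where
  "trajectory F x0 u b 0 = x0"
| "trajectory F x0 u b (Suc k) = F (trajectory F x0 u b k) (u k) b"

definition max_input_norm :: "(nat \<Rightarrow> real vec) \<Rightarrow> nat \<Rightarrow> real" where
  "max_input_norm u k = Max (insert 0 ((\<lambda>h. vec_inf_norm (u h)) ` {..<k}))"

(* X, U and B are the sets of states, inputs and biases. The state at time k depends only on
   u 0, ..., u (k - 1), so only these inputs are required to lie in U. *)

definition ISS_inf ::
  "(real vec \<Rightarrow> real vec \<Rightarrow> real vec \<Rightarrow> real vec) \<Rightarrow> real vec set \<Rightarrow> real vec set \<Rightarrow> real vec set
     \<Rightarrow> bool" where
  "ISS_inf F X U B \<longleftrightarrow>
     (\<exists>\<beta> \<gamma>\<^sub>u \<gamma>\<^sub>b. class_KL \<beta> \<and> class_K_inf \<gamma>\<^sub>u \<and> class_K_inf \<gamma>\<^sub>b \<and>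
        (\<forall>k. \<forall>x0\<in>X. \<forall>u. (\<forall>h<k. u h \<in> U) \<longrightarrow> (\<forall>b\<in>B.
           vec_inf_norm (trajectory F x0 u b k)
             \<le> \<beta> (vec_inf_norm x0) k + \<gamma>\<^sub>u (max_input_norm u k) + \<gamma>\<^sub>b (vec_inf_norm b))))"


(* The gates f, i, o and the cell candidate g. *)
datatype gate = Forget | Input | Output | Cand

definition pre_activation ::
  "(gate \<Rightarrow> real mat) \<Rightarrow> (gate \<Rightarrow> real mat) \<Rightarrow> (gate \<Rightarrow> real vec)
     \<Rightarrow> real vec \<Rightarrow> real vec \<Rightarrow> gate \<Rightarrow> real vec" where
  "pre_activation W R b u h j = W j *\<^sub>v u + R j *\<^sub>v h + b j"

definition lstm_step ::
  "nat \<Rightarrow> (gate \<Rightarrow> real mat) \<Rightarrow> (gate \<Rightarrow> real mat) \<Rightarrow> (gate \<Rightarrow> real vec)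
     \<Rightarrow> real vec \<Rightarrow> real vec \<Rightarrow> real vec" where
  "lstm_step n W R b x u =
     (let c = vec_first x n;
          h = vec_last x n;
          f = map_vec sigmoid (pre_activation W R b u h Forget);
          i = map_vec sigmoid (pre_activation W R b u h Input);
          out = map_vec sigmoid (pre_activation W R b u h Output);
          g = map_vec tanh (pre_activation W R b u h Cand);
          c' = hadamard f c + hadamard i g
      in c' @\<^sub>v hadamard out (map_vec tanh c'))"

definition lstm_states :: "nat \<Rightarrow> real vec set" where
  "lstm_states n =
     {c @\<^sub>v h | c h. c \<in> carrier_vec n \<and> h \<in> carrier_vec n \<and> (\<forall>i<n. -1 < h $ i \<and> h $ i < 1)}"

definition layer_input_dim :: "nat \<Rightarrow> (nat \<Rightarrow> nat) \<Rightarrow> nat \<Rightarrow> nat" where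
  "layer_input_dim n_u n_hu l = (if l = 1 then n_u else n_hu (l - 1))"

definition layer_input_max :: "real vec \<Rightarrow> (nat \<Rightarrow> nat) \<Rightarrow> nat \<Rightarrow> real vec" where
  "layer_input_max u_max n_hu l = (if l = 1 then u_max else vec (n_hu (l - 1)) (\<lambda>_. 1))"

definition input_box :: "real vec \<Rightarrow> real vec set" where
  "input_box v = {u \<in> carrier_vec (dim_vec v). - v \<le> u \<and> u \<le> v}"

(* The matrix is [W v, R, b], whose first column is the vector W v. *)
definition gate_bound :: "nat \<Rightarrow> real mat \<Rightarrow> real mat \<Rightarrow> real vec \<Rightarrow> real vec \<Rightarrow> real" where
  "gate_bound n W R b v =
     sigmoid (mat_inf_norm (mat_of_cols n ([W *\<^sub>v v] @ cols R @ [b])))"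

end

theory Submission
  imports Defs
begin

(* Since \<bar>tanh x\<bar> \<le> \<bar>x\<bar>, one step of the layer satisfies |x'| \<le> f |x| + i (|R_g| |x| + |W_g| |u| + |b_g|)
   whenever f and i bound the forget and input gates. The bounds in the hypothesis involve W v
   and not |W| v, so if W has entries of both signs they need not bound the gates on the whole
   input box. They do bound them at u = 0, hence by continuity the step contracts if |u| \<le> d for
   some d > 0. If |u| > d, the forget gate is still bounded by some r < 1 on the box, while the
   other summand of the cell state is at most 1 \<le> |u| / d, which the input gain absorbs. *)

section \<open>Max norm and induced matrix norm\<close>

lemma vec_inf_norm_le_iff:
  "vec_inf_norm v \<le> c \<longleftrightarrow> 0 \<le> c \<and> (\<forall>i<dim_vec v. \<bar>v $ i\<bar> \<le> c)"
  unfolding vec_inf_norm_def by (subst Max_le_iff) auto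

lemma vec_inf_norm_nonneg: "0 \<le> vec_inf_norm v"
  using vec_inf_norm_le_iff[of v "vec_inf_norm v"] by simp

lemma abs_index_le_vec_inf_norm: "i < dim_vec v \<Longrightarrow> \<bar>v $ i\<bar> \<le> vec_inf_norm v"
  using vec_inf_norm_le_iff[of v "vec_inf_norm v"] by simp

lemma mat_inf_norm_nonneg: "0 \<le> mat_inf_norm A"
  unfolding mat_inf_norm_def by (rule Max_ge) auto

lemma row_sum_le_mat_inf_norm:
  "i < dim_row A \<Longrightarrow> (\<Sum>j<dim_col A. \<bar>A $$ (i, j)\<bar>) \<le> mat_inf_norm A"
  unfolding mat_inf_norm_def by (rule Max_ge) auto

text \<open>Stated for a single row: a row sum of \<open>R\<close> plus the bias entry of the same
  row stays below the norm of the concatenated matrix, whereas the sum of the separate norms of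
  \<open>R\<close> and \<open>b\<close> may exceed it.\<close>

lemma abs_mult_mat_vec_le_row_sum:
  fixes A :: "real mat"
  assumes "i < dim_row A" "dim_vec x = dim_col A" "\<And>j. j < dim_col A \<Longrightarrow> \<bar>x $ j\<bar> \<le> c"
  shows "\<bar>(A *\<^sub>v x) $ i\<bar> \<le> (\<Sum>j<dim_col A. \<bar>A $$ (i, j)\<bar>) * c"
proof -
  have "(A *\<^sub>v x) $ i = (\<Sum>j<dim_col A. A $$ (i, j) * x $ j)"
    using assms(1,2) by (auto simp: scalar_prod_def lessThan_atLeast0 intro!: sum.cong)
  also have "\<bar>\<dots>\<bar> \<le> (\<Sum>j<dim_col A. \<bar>A $$ (i, j) * x $ j\<bar>)"
    by (rule sum_abs)
  also have "\<dots> \<le> (\<Sum>j<dim_col A. \<bar>A $$ (i, j)\<bar> * c)"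
    using assms(3) by (intro sum_mono) (auto simp: abs_mult intro!: mult_left_mono)
  finally show ?thesis by (simp add: sum_distrib_right)
qed

lemma abs_mult_mat_vec_le:
  assumes "i < dim_row A" "dim_vec x = dim_col A"
  shows "\<bar>(A *\<^sub>v x) $ i\<bar> \<le> mat_inf_norm A * vec_inf_norm x"
proof -
  have "\<bar>(A *\<^sub>v x) $ i\<bar> \<le> (\<Sum>j<dim_col A. \<bar>A $$ (i, j)\<bar>) * vec_inf_norm x"
    using assms by (intro abs_mult_mat_vec_le_row_sum) (auto intro: abs_index_le_vec_inf_norm)
  also have "\<dots> \<le> mat_inf_norm A * vec_inf_norm x"
    using assms by (intro mult_right_mono row_sum_le_mat_inf_norm vec_inf_norm_nonneg)
  finally show ?thesis .
qed

text \<open>Only the first column is dropped, so \<open>w\<close> is arbitrary. What remains of the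
  row bounds the pre-activation of a gate at zero input.\<close>

lemma row_sum_augmented_le:
  assumes "R \<in> carrier_mat n n" "i < n"
  shows "(\<Sum>j<n. \<bar>R $$ (i, j)\<bar>) + \<bar>b $ i\<bar> \<le> mat_inf_norm (mat_of_cols n ([w] @ cols R @ [b]))"
    (is "_ \<le> mat_inf_norm ?M")
proof -
  have dims: "dim_row ?M = n" "dim_col ?M = Suc (Suc n)" using assms by auto
  have "(\<Sum>j<n. \<bar>R $$ (i, j)\<bar>) + \<bar>b $ i\<bar> \<le> \<bar>w $ i\<bar> + (\<Sum>j<n. \<bar>R $$ (i, j)\<bar>) + \<bar>b $ i\<bar>"
    by simp
  also have "\<dots> = (\<Sum>j<Suc (Suc n). \<bar>?M $$ (i, j)\<bar>)"
    using assms
    by (subst sum.lessThan_Suc_shift, subst sum.lessThan_Suc)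
       (auto simp: mat_of_cols_index nth_append intro!: sum.cong)
  also have "\<dots> \<le> mat_inf_norm ?M"
    using row_sum_le_mat_inf_norm[of i ?M] assms(2) dims by simp
  finally show ?thesis .
qed

section \<open>Scalar activation functions\<close>

lemma abs_tanh_le_abs: "\<bar>tanh x\<bar> \<le> \<bar>x :: real\<bar>"
proof -
  have "(\<lambda>y::real. y - tanh y) 0 \<le> (\<lambda>y. y - tanh y) \<bar>x\<bar>"
  proof (rule DERIV_nonneg_imp_nondecreasing[where f = "\<lambda>y. y - tanh y"])
    \<comment> \<open>The derivative of y - tanh y is 1 - (1 - tanh^2 y).\<close>
    show "\<exists>d. ((\<lambda>y::real. y - tanh y) has_real_derivative d) (at y) \<and> 0 \<le> d" for y
      by (rule exI[of _ "(tanh y)\<^sup>2"]) (auto intro!: derivative_eq_intros)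
  qed simp
  \<comment> \<open>Since tanh is odd and nonnegative on the nonnegative reals, tanh |x| = |tanh
    x|.\<close>
  then show ?thesis by simp
qed

lemma abs_tanh_less_1: "\<bar>tanh x :: real\<bar> < 1"
  using tanh_real_bounds[of x] by auto

lemma sigmoid_pos: "0 < sigmoid x"
  by (simp add: sigmoid_def add_pos_pos)

lemma sigmoid_less_1: "sigmoid x < 1"
  by (simp add: sigmoid_def field_simps add_pos_pos)

lemma sigmoid_mono: "x \<le> y \<Longrightarrow> sigmoid x \<le> sigmoid y"
  unfolding sigmoid_def by (intro divide_left_mono) (auto simp: add_pos_pos)

lemma isCont_sigmoid: "isCont sigmoid x"
proof -
  have "1 + exp (- x) \<noteq> 0" using exp_gt_zero[of "- x"] by linarith
  then show ?thesis unfolding sigmoid_def[abs_def] by (intro continuous_intros)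
qed

section \<open>Comparison functions and a one-step criterion for stability\<close>

lemma class_KL_geometric:
  assumes "0 < r" "r < 1"
  shows "class_KL (\<lambda>s k. r ^ k * s)"
proof -
  \<comment> \<open>Positivity of the rate matters here: for r = 0 and k \<ge> 1 the function would
    vanish identically instead of increasing strictly.\<close>
  have "class_K (\<lambda>s. r ^ k * s)" for k
    using assms unfolding class_K_def
    by (auto intro!: continuous_intros strict_mono_onI mult_strict_left_mono)
  moreover have "decseq (\<lambda>k. r ^ k * s)" if "s \<ge> 0" for s
    using assms that
    by (auto intro!: decseq_SucI mult_right_mono mult_left_le_one_le)
  moreover have "(\<lambda>k. r ^ k * s) \<longlonglongrightarrow> 0" for s
    using tendsto_mult_left_zero[OF LIMSEQ_realpow_zero] assms by simp
  ultimately show ?thesis unfolding class_KL_def by blast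
qed

lemma class_K_inf_linear:
  assumes "0 < K"
  shows "class_K_inf (\<lambda>s. K * s)"
  using assms unfolding class_K_inf_def class_K_def
  by (auto intro!: continuous_intros strict_mono_onI mult_strict_left_mono
      filterlim_tendsto_pos_mult_at_top[OF tendsto_const] filterlim_ident)

text \<open>Iterating the one-step estimate sums the input and bias terms to a geometric series,
  which divides the gains by 1 - r. Invariance of \<open>X\<close> keeps the estimate applicable
  along the whole trajectory.\<close>

lemma ISS_inf_if_affine_contraction:
  assumes r: "0 < r" "r < 1" and K: "0 < K\<^sub>u" "0 < K\<^sub>b"
    and inv: "\<And>x u b. x \<in> X \<Longrightarrow> u \<in> U \<Longrightarrow> b \<in> B \<Longrightarrow> F x u b \<in> X"
    and step: "\<And>x u b. x \<in> X \<Longrightarrow> u \<in> U \<Longrightarrow> b \<in> B \<Longrightarrow>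
      vec_inf_norm (F x u b) \<le> r * vec_inf_norm x + K\<^sub>u * vec_inf_norm u + K\<^sub>b * vec_inf_norm b"
  shows "ISS_inf F X U B"
proof -
  \<comment> \<open>A single \<open>M\<close> bounds all inputs before time k, so every step of the
    induction adds the same disturbance.\<close>
  have bound: "trajectory F x0 u b k \<in> X \<and> vec_inf_norm (trajectory F x0 u b k)
      \<le> r ^ k * vec_inf_norm x0 + (K\<^sub>u * M + K\<^sub>b * vec_inf_norm b) / (1 - r)"
    if "x0 \<in> X" "b \<in> B" "0 \<le> M" "\<forall>h<k. u h \<in> U \<and> vec_inf_norm (u h) \<le> M" for x0 b u k M
    using that(4)
  proof (induction k)
    case 0
    show ?case using that K r by (simp add: vec_inf_norm_nonneg)
  next
    case (Suc k)
    let ?x = "trajectory F x0 u b k" and ?D = "K\<^sub>u * M + K\<^sub>b * vec_inf_norm b"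
    have IH: "?x \<in> X" "vec_inf_norm ?x \<le> r ^ k * vec_inf_norm x0 + ?D / (1 - r)"
      using Suc by auto
    have u: "u k \<in> U" "vec_inf_norm (u k) \<le> M" using Suc.prems by auto
    have "vec_inf_norm (F ?x (u k) b) \<le> r * vec_inf_norm ?x + K\<^sub>u * vec_inf_norm (u k) + K\<^sub>b * vec_inf_norm b"
      using step IH u that by blast
    also have "\<dots> \<le> r * (r ^ k * vec_inf_norm x0 + ?D / (1 - r)) + ?D"
      using mult_left_mono[OF IH(2), of r] mult_left_mono[OF u(2), of "K\<^sub>u"] r K by linarith
    \<comment> \<open>\<open>?D / (1 - r)\<close> is the fixed point of the map taking s to r s +
      \<open>?D\<close>, so the induction reproduces it.\<close>
    also have "\<dots> = r ^ Suc k * vec_inf_norm x0 + ?D / (1 - r)"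
      using r by (simp add: field_simps)
    finally show ?case using inv IH u that by simp
  qed
  let ?\<beta> = "\<lambda>s k. r ^ k * s" and ?\<gamma>\<^sub>u = "\<lambda>s. K\<^sub>u / (1 - r) * s" and ?\<gamma>\<^sub>b = "\<lambda>s. K\<^sub>b / (1 - r) * s"
  have "vec_inf_norm (trajectory F x0 u b k)
      \<le> ?\<beta> (vec_inf_norm x0) k + ?\<gamma>\<^sub>u (max_input_norm u k) + ?\<gamma>\<^sub>b (vec_inf_norm b)"
    if "x0 \<in> X" "\<forall>h<k. u h \<in> U" "b \<in> B" for k x0 u b
  proof -
    \<comment> \<open>The inserted 0 yields this also for k = 0, when there are no inputs.\<close>
    have "0 \<le> max_input_norm u k" unfolding max_input_norm_def by (rule Max_ge) auto
    moreover have "vec_inf_norm (u h) \<le> max_input_norm u k" if "h < k" for h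
      unfolding max_input_norm_def using that by (intro Max_ge) auto
    ultimately show ?thesis
      using bound[of x0 b "max_input_norm u k" k u] that by (simp add: add_divide_distrib)
  qed
  moreover have "class_KL ?\<beta>" "class_K_inf ?\<gamma>\<^sub>u" "class_K_inf ?\<gamma>\<^sub>b"
    using r K by (intro class_KL_geometric class_K_inf_linear divide_pos_pos; simp)+
  ultimately show ?thesis unfolding ISS_inf_def by blast
qed

section \<open>Upper bounds on the gates\<close>

lemma abs_pre_activation_le:
  assumes "W j \<in> carrier_mat n m" "R j \<in> carrier_mat n n" "b j \<in> carrier_vec n"
    and "u \<in> carrier_vec m" "h \<in> carrier_vec n" "i < n"
  shows "\<bar>pre_activation W R b u h j $ i\<bar>
    \<le> mat_inf_norm (W j) * vec_inf_norm u + \<bar>(R j *\<^sub>v h) $ i\<bar> + \<bar>b j $ i\<bar>"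
proof -
  have "pre_activation W R b u h j $ i = (W j *\<^sub>v u) $ i + (R j *\<^sub>v h) $ i + b j $ i"
    using assms unfolding pre_activation_def
    by (simp add: index_add_vec carrier_matD carrier_vecD del: index_mult_mat_vec)
  then show ?thesis
    using abs_mult_mat_vec_le[of i "W j" u] assms by simp
qed

text \<open>As the entries of \<open>h\<close> are at most 1 in absolute value, the recurrent and
  bias terms stay below the norm of the concatenated matrix, and the input adds at most |W_j| t. For
  \<open>w\<close> equal to W_j v and t = 0 the right-hand side is
  \<open>gate_bound\<close>.\<close>

lemma sigmoid_pre_activation_le:
  assumes "W j \<in> carrier_mat n m" "R j \<in> carrier_mat n n" "b j \<in> carrier_vec n"
    and "u \<in> carrier_vec m" "h \<in> carrier_vec n" "\<forall>i<n. \<bar>h $ i\<bar> \<le> 1" "i < n"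
    and "vec_inf_norm u \<le> t"
  shows "sigmoid (pre_activation W R b u h j $ i)
    \<le> sigmoid (mat_inf_norm (mat_of_cols n ([w] @ cols (R j) @ [b j])) + mat_inf_norm (W j) * t)"
proof (rule sigmoid_mono)
  have "\<bar>(R j *\<^sub>v h) $ i\<bar> \<le> (\<Sum>k<n. \<bar>R j $$ (i, k)\<bar>) * 1"
    using abs_mult_mat_vec_le_row_sum[of i "R j" h 1] assms by simp
  then show "pre_activation W R b u h j $ i
      \<le> mat_inf_norm (mat_of_cols n ([w] @ cols (R j) @ [b j])) + mat_inf_norm (W j) * t"
    using abs_pre_activation_le[where W = W and R = R and b = b, OF assms(1-5) \<open>i < n\<close>]
      row_sum_augmented_le[OF assms(2) \<open>i < n\<close>, of "b j" w]
      mult_left_mono[OF assms(8) mat_inf_norm_nonneg[of "W j"]] by linarith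
qed

section \<open>One step of the layer\<close>

lemma lstm_step_append:
  fixes W R b u h
  defines "p \<equiv> \<lambda>j i. pre_activation W R b u h j $ i"
  assumes "\<And>j. b j \<in> carrier_vec n" "c \<in> carrier_vec n" "h \<in> carrier_vec n"
  defines "c' \<equiv> vec n (\<lambda>i. sigmoid (p Forget i) * c $ i + sigmoid (p Input i) * tanh (p Cand i))"
  shows "lstm_step n W R b (c @\<^sub>v h) u = c' @\<^sub>v vec n (\<lambda>i. sigmoid (p Output i) * tanh (c' $ i))"
proof -
  have [simp]: "dim_vec (pre_activation W R b u h j) = n" for j
    using assms(2)[of j] by (simp add: pre_activation_def)
  have "vec_first (c @\<^sub>v h) n = c" "vec_last (c @\<^sub>v h) n = h"
    using assms by (auto simp: vec_first_def vec_last_def)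
  moreover have "hadamard (map_vec sigmoid (pre_activation W R b u h Forget)) c
      + hadamard (map_vec sigmoid (pre_activation W R b u h Input))
          (map_vec tanh (pre_activation W R b u h Cand)) = c'"
    unfolding c'_def p_def by (rule eq_vecI) (auto simp: hadamard_def)
  moreover have "hadamard (map_vec sigmoid (pre_activation W R b u h Output)) (map_vec tanh c')
      = vec n (\<lambda>i. sigmoid (p Output i) * tanh (c' $ i))"
    by (rule eq_vecI) (auto simp: hadamard_def p_def c'_def)
  ultimately show ?thesis unfolding lstm_step_def Let_def by simp
qed

text \<open>The bounds \<open>f\<close> and \<open>g\<close> are parameters because small and large
  inputs call for different ones. The hidden half needs no estimate of its own: |h'| \<le> |tanh c'|
  \<le> |c'| entrywise. Strictness of |tanh| < 1 keeps the hidden state in the open cube.\<close>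

lemma lstm_step_norm_le:
  assumes b: "\<And>j. b j \<in> carrier_vec n" and c: "c \<in> carrier_vec n" and h: "h \<in> carrier_vec n"
    and f: "\<And>i. i < n \<Longrightarrow> sigmoid (pre_activation W R b u h Forget $ i) \<le> f" "0 \<le> f"
    and g: "\<And>i. i < n \<Longrightarrow> sigmoid (pre_activation W R b u h Input $ i)
      * \<bar>tanh (pre_activation W R b u h Cand $ i)\<bar> \<le> g" "0 \<le> g"
  shows "lstm_step n W R b (c @\<^sub>v h) u \<in> lstm_states n"
    and "vec_inf_norm (lstm_step n W R b (c @\<^sub>v h) u) \<le> f * vec_inf_norm (c @\<^sub>v h) + g"
proof -
  define p where "p = (\<lambda>j i. pre_activation W R b u h j $ i)"
  define c' where
    "c' = vec n (\<lambda>i. sigmoid (p Forget i) * c $ i + sigmoid (p Input i) * tanh (p Cand i))"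
  define h' where "h' = vec n (\<lambda>i. sigmoid (p Output i) * tanh (c' $ i))"
  have eq: "lstm_step n W R b (c @\<^sub>v h) u = c' @\<^sub>v h'"
    unfolding h'_def c'_def p_def using lstm_step_append[OF b c h] .
  have h'_le: "\<bar>h' $ i\<bar> \<le> \<bar>tanh (c' $ i)\<bar>" if "i < n" for i
    using that sigmoid_pos[of "p Output i"] sigmoid_less_1[of "p Output i"]
    by (auto simp: h'_def abs_mult intro!: mult_left_le_one_le)
  then have "\<bar>h' $ i\<bar> < 1" if "i < n" for i
    using that abs_tanh_less_1 le_less_trans by blast
  then show "lstm_step n W R b (c @\<^sub>v h) u \<in> lstm_states n"
    unfolding eq lstm_states_def
    by (fastforce simp: h'_def c'_def abs_less_iff)
  have c'_le: "\<bar>c' $ i\<bar> \<le> f * vec_inf_norm (c @\<^sub>v h) + g" if "i < n" for i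
  proof -
    have "\<bar>c $ i\<bar> \<le> vec_inf_norm (c @\<^sub>v h)"
      using abs_index_le_vec_inf_norm[of i "c @\<^sub>v h"] that c by simp
    then have "sigmoid (p Forget i) * \<bar>c $ i\<bar> \<le> f * vec_inf_norm (c @\<^sub>v h)"
      using f that unfolding p_def by (intro mult_mono) auto
    moreover have "sigmoid (p Input i) * \<bar>tanh (p Cand i)\<bar> \<le> g" using g that by (simp add: p_def)
    moreover have "\<bar>c' $ i\<bar> \<le> sigmoid (p Forget i) * \<bar>c $ i\<bar> + sigmoid (p Input i) * \<bar>tanh (p Cand i)\<bar>"
      using that abs_triangle_ineq[of "sigmoid (p Forget i) * c $ i"
          "sigmoid (p Input i) * tanh (p Cand i)"]
      by (simp add: c'_def abs_mult sigmoid_pos less_imp_le)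
    ultimately show ?thesis by linarith
  qed
  have "\<bar>(c' @\<^sub>v h') $ i\<bar> \<le> f * vec_inf_norm (c @\<^sub>v h) + g" if "i < n + n" for i
  proof (cases "i < n")
    case True
    then show ?thesis using c'_le by (simp add: c'_def)
  next
    case False
    then have i: "i - n < n" using that by simp
    have "\<bar>h' $ (i - n)\<bar> \<le> f * vec_inf_norm (c @\<^sub>v h) + g"
      using h'_le[OF i] abs_tanh_le_abs[of "c' $ (i - n)"] c'_le[OF i] by linarith
    then show ?thesis using False that by (simp add: c'_def h'_def)
  qed
  then show "vec_inf_norm (lstm_step n W R b (c @\<^sub>v h) u) \<le> f * vec_inf_norm (c @\<^sub>v h) + g"
    using f(2) g(2) by (simp add: eq vec_inf_norm_le_iff vec_inf_norm_nonneg c'_def h'_def)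
qed

section \<open>Stability of the layer on the input box\<close>

lemma vec_inf_norm_input_box_le: "u \<in> input_box v \<Longrightarrow> vec_inf_norm u \<le> vec_inf_norm v"
proof -
  assume u: "u \<in> input_box v"
  have "\<bar>u $ i\<bar> \<le> vec_inf_norm v" if "i < dim_vec v" for i
  proof -
    have "\<bar>u $ i\<bar> \<le> \<bar>v $ i\<bar>"
      using u that unfolding input_box_def less_eq_vec_def by fastforce
    then show ?thesis using abs_index_le_vec_inf_norm[OF that] by linarith
  qed
  then show ?thesis using u by (auto simp: vec_inf_norm_le_iff vec_inf_norm_nonneg input_box_def)
qed

lemma lstm_layer_ISS_inf:
  assumes W: "\<And>j. W j \<in> carrier_mat n m" and R: "\<And>j. R j \<in> carrier_mat n n"
    and b: "\<And>j. b j \<in> carrier_vec n" and v: "v \<in> carrier_vec m"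
    and small: "gate_bound n (W Forget) (R Forget) (b Forget) v
      + gate_bound n (W Input) (R Input) (b Input) v * mat_inf_norm (R Cand) < 1"
  shows "ISS_inf (\<lambda>x u b_g. lstm_step n W R (b(Cand := b_g)) x u)
    (lstm_states n) (input_box v) (carrier_vec n)"
proof -
  \<comment> \<open>For a gate other than \<open>Cand\<close>, \<open>G j t\<close> bounds it while
    the input norm is at most t; \<open>G j 0\<close> is its \<open>gate_bound\<close>.\<close>
  define G where "G j t = sigmoid (mat_inf_norm (mat_of_cols n ([W j *\<^sub>v v] @ cols (R j) @ [b j]))
    + mat_inf_norm (W j) * t)" for j t
  have G_less_1: "G j t < 1" and G_pos: "0 < G j t" for j t
    unfolding G_def by (auto intro: sigmoid_less_1 sigmoid_pos)
  let ?\<rho> = "\<lambda>t. G Forget t + G Input t * mat_inf_norm (R Cand)"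
  have "isCont ?\<rho> 0"
    unfolding G_def by (intro continuous_intros isCont_o2[OF _ isCont_sigmoid])
  then have "(?\<rho> \<longlongrightarrow> ?\<rho> 0) (at 0)" by (simp add: isCont_def)
  moreover have "?\<rho> 0 < 1" using small by (simp add: G_def gate_bound_def)
  ultimately have "eventually (\<lambda>t. ?\<rho> t < 1) (at 0)" by (rule order_tendstoD)
  then obtain \<epsilon> where \<epsilon>: "\<epsilon> > 0" "\<And>t. t \<noteq> 0 \<Longrightarrow> dist t 0 < \<epsilon> \<Longrightarrow> ?\<rho> t < 1"
    unfolding eventually_at by auto
  \<comment> \<open>The neighbourhood is punctured at 0, so a point strictly between 0 and
    \<epsilon> is taken.\<close>
  define \<delta> where "\<delta> = \<epsilon> / 2"
  have \<delta>: "\<delta> > 0" "?\<rho> \<delta> < 1" using \<epsilon> by (auto simp: \<delta>_def)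
  \<comment> \<open>The larger of the two rates: the full contraction factor for inputs of norm at
    most \<delta>, and the forget gate alone over the whole box.\<close>
  define r where "r = max (?\<rho> \<delta>) (G Forget (vec_inf_norm v))"
  have r: "0 < r" "r < 1" using \<delta> G_less_1 G_pos by (auto simp: r_def less_max_iff_disj)
  \<comment> \<open>The first summand handles the input inside the candidate when the input is
    small; 1 / \<delta> pays for the constant 1 when its norm exceeds \<delta>.\<close>
  define K where "K = mat_inf_norm (W Cand) + 1 / \<delta>"
  have K: "0 < K" using \<delta> mat_inf_norm_nonneg[of "W Cand"] by (simp add: K_def add_nonneg_pos)
  have step: "lstm_step n W R (b(Cand := b_g)) x u \<in> lstm_states n \<and>
    vec_inf_norm (lstm_step n W R (b(Cand := b_g)) x u)
      \<le> r * vec_inf_norm x + K * vec_inf_norm u + 1 * vec_inf_norm b_g"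
    if x_in: "x \<in> lstm_states n" and u_in: "u \<in> input_box v" and b_g: "b_g \<in> carrier_vec n"
    for x u b_g
  proof -
    let ?b = "b(Cand := b_g)" and ?U = "vec_inf_norm u" and ?B = "vec_inf_norm b_g"
    obtain c h where x: "x = c @\<^sub>v h" and c: "c \<in> carrier_vec n" and h: "h \<in> carrier_vec n"
      and h1: "\<forall>i<n. -1 < h $ i \<and> h $ i < 1"
      using x_in unfolding lstm_states_def by blast
    have u: "u \<in> carrier_vec m" using u_in v by (auto simp: input_box_def)
    have b': "?b j \<in> carrier_vec n" for j using b b_g by simp
    \<comment> \<open>Updating the bias at \<open>Cand\<close> leaves the other gates unchanged, so
      these bounds, and with them r and \<open>K\<close>, do not depend on
      \<open>b_g\<close>.\<close>
    have gate: "sigmoid (pre_activation W R ?b u h j $ i) \<le> G j t"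
      if "j \<noteq> Cand" "i < n" "?U \<le> t" for i j t
      using sigmoid_pre_activation_le[where W = W and R = R and b = ?b and j = j and i = i and t = t and w = "W j *\<^sub>v v",
          OF W R b' u h] h1 that
      unfolding G_def by (force simp: abs_le_iff)
    show ?thesis
    proof (cases "?U \<le> \<delta>")
      case True
      \<comment> \<open>Only the recurrent term keeps the factor \<open>G Input \<delta>\<close>,
        which the contraction needs; in the input and bias terms it is replaced by 1, hence the bias
        gain 1.\<close>
      define g where
        "g = G Input \<delta> * mat_inf_norm (R Cand) * vec_inf_norm x + mat_inf_norm (W Cand) * ?U + ?B"
      have nonneg: "0 \<le> mat_inf_norm (R Cand) * vec_inf_norm x" "0 \<le> mat_inf_norm (W Cand) * ?U"
        "0 \<le> ?B" by (simp_all add: mat_inf_norm_nonneg vec_inf_norm_nonneg)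
      have cand: "sigmoid (pre_activation W R ?b u h Input $ i)
          * \<bar>tanh (pre_activation W R ?b u h Cand $ i)\<bar> \<le> g" if i: "i < n" for i
      proof -
        have "vec_inf_norm h \<le> vec_inf_norm x"
          unfolding vec_inf_norm_le_iff[of h]
        proof (intro conjI allI impI vec_inf_norm_nonneg)
          fix k assume "k < dim_vec h"
          \<comment> \<open>The vector \<open>h\<close> occupies the entries of \<open>x\<close>
            from index n on.\<close>
          then show "\<bar>h $ k\<bar> \<le> vec_inf_norm x"
            using abs_index_le_vec_inf_norm[of "n + k" x] c h x by simp
        qed
        then have "\<bar>(R Cand *\<^sub>v h) $ i\<bar> \<le> mat_inf_norm (R Cand) * vec_inf_norm x"
          using abs_mult_mat_vec_le[of i "R Cand" h] R[of Cand] h i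
            mult_left_mono[OF _ mat_inf_norm_nonneg[of "R Cand"]] by fastforce
        moreover have "\<bar>b_g $ i\<bar> \<le> ?B"
          using abs_index_le_vec_inf_norm[of i b_g] i b_g by simp
        ultimately have "\<bar>tanh (pre_activation W R ?b u h Cand $ i)\<bar>
            \<le> mat_inf_norm (R Cand) * vec_inf_norm x + (mat_inf_norm (W Cand) * ?U + ?B)"
          using abs_pre_activation_le[where W = W and R = R and b = ?b and j = Cand, OF W R b' u h i]
            abs_tanh_le_abs[of "pre_activation W R ?b u h Cand $ i"] by simp
        then have "sigmoid (pre_activation W R ?b u h Input $ i)
            * \<bar>tanh (pre_activation W R ?b u h Cand $ i)\<bar>
          \<le> G Input \<delta> * (mat_inf_norm (R Cand) * vec_inf_norm x
              + (mat_inf_norm (W Cand) * ?U + ?B))"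
          using gate[of Input i \<delta>] True i G_pos[of Input \<delta>] by (intro mult_mono) auto
        also have "\<dots> \<le> g"
          using mult_right_mono[of "G Input \<delta>" 1 "mat_inf_norm (W Cand) * ?U + ?B"]
            nonneg G_less_1[of Input \<delta>] by (simp add: g_def algebra_simps)
        finally show ?thesis .
      qed
      have g0: "0 \<le> g"
        using nonneg G_pos[of Input \<delta>] by (simp add: g_def mult.assoc)
      note * = lstm_step_norm_le[where W=W and R=R and f="G Forget \<delta>" and g=g, OF b' c h
          gate[OF _ _ True] less_imp_le[OF G_pos] cand g0, simplified]
      \<comment> \<open>The forget gate and the recurrent part of \<open>g\<close> together multiply
        the norm of \<open>x\<close> by exactly \<open>?\<rho> \<delta>\<close>.\<close>
      have "?\<rho> \<delta> * vec_inf_norm x \<le> r * vec_inf_norm x"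
        by (intro mult_right_mono vec_inf_norm_nonneg) (simp add: r_def)
      moreover have "0 \<le> 1 / \<delta> * ?U" using \<delta> by (simp add: vec_inf_norm_nonneg)
      ultimately show ?thesis
        using * unfolding x[symmetric] by (simp add: g_def K_def algebra_simps)
    next
      case False
      \<comment> \<open>For large inputs boundedness of tanh suffices: the candidate contributes a
        constant, and the recurrent weights do not enter the rate.\<close>
      have cand: "sigmoid (pre_activation W R ?b u h Input $ i)
          * \<bar>tanh (pre_activation W R ?b u h Cand $ i)\<bar> \<le> 1" for i
        using abs_tanh_less_1 sigmoid_less_1 sigmoid_pos
        by (intro mult_le_one) (auto intro: less_imp_le)
      note * = lstm_step_norm_le[where W=W and R=R and f="G Forget (vec_inf_norm v)" and g=1,
          OF b' c h gate[OF _ _ vec_inf_norm_input_box_le[OF u_in]] less_imp_le[OF G_pos] cand,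
          simplified]
      have "G Forget (vec_inf_norm v) * vec_inf_norm x \<le> r * vec_inf_norm x"
        by (intro mult_right_mono vec_inf_norm_nonneg) (simp add: r_def)
      moreover have "1 \<le> 1 / \<delta> * ?U" using False \<delta> by (simp add: field_simps)
      moreover have "0 \<le> mat_inf_norm (W Cand) * ?U" "0 \<le> ?B"
        by (simp_all add: mat_inf_norm_nonneg vec_inf_norm_nonneg)
      ultimately show ?thesis
        using * unfolding x[symmetric] by (simp add: K_def algebra_simps)
    qed
  qed
  show ?thesis
    using step by (intro ISS_inf_if_affine_contraction[OF r K, of 1]) auto
qed

theorem theorem1:
  fixes L l n_u :: nat
    and n_hu :: "nat \<Rightarrow> nat"
    and W R :: "nat \<Rightarrow> gate \<Rightarrow> real mat"
    and b :: "nat \<Rightarrow> gate \<Rightarrow> real vec"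
    and u_max :: "real vec"
  defines "n \<equiv> n_hu l"
    and "m \<equiv> layer_input_dim n_u n_hu l"
    and "v \<equiv> layer_input_max u_max n_hu l"
  assumes "1 \<le> L" and "l \<in> {1..L}" and "1 \<le> n"
    and "\<And>j. W l j \<in> carrier_mat n m"
    and "\<And>j. R l j \<in> carrier_mat n n"
    and "\<And>j. b l j \<in> carrier_vec n"
    and "u_max \<in> carrier_vec n_u"
    and "gate_bound n (W l Forget) (R l Forget) (b l Forget) v
           + gate_bound n (W l Input) (R l Input) (b l Input) v * mat_inf_norm (R l Cand) < 1"
  shows "ISS_inf (\<lambda>x u b_g. lstm_step n (W l) (R l) ((b l)(Cand := b_g)) x u)
           (lstm_states n) (input_box v) (carrier_vec n)"
proof (rule lstm_layer_ISS_inf)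
  \<comment> \<open>The first layer and the later ones differ only in the vector bounding the
    inputs; it has the input dimension in both cases.\<close>
  show "v \<in> carrier_vec m"
    using assms(10) by (simp add: v_def m_def layer_input_max_def layer_input_dim_def)
qed (use assms in auto)

end
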